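(* Define the Mahalanobis distance by $D_{\mathcal{M}}(\mathbf{x},\boldsymbol{\mu},\Sigma)=(\mathbf{x}-\boldsymbol{\mu})^{\top}\Sigma^{-1}(\mathbf{x}-\boldsymbol{\mu})$. Let the parameters of the Gaussian distribution $\mathcal{N}(\bar{\boldsymbol{\mu}}_t,\bar\Sigma_t)$ on $\mathbb{R}^n$ evolve according to $$\frac{d\bar{\boldsymbol{\mu}}_t}{dt}=-\bar\Sigma_t\,\mathbb{E}_{\mathbf{x}\sim\mathcal{N}(\bar{\boldsymbol{\mu}}_t,\bar\Sigma_t)}[\nabla_{\mathbf{x}}V(\mathbf{x})],\qquad \frac{d\bar\Sigma_t^{-1}}{dt}=\mathbb{E}_{\mathbf{x}\sim\mathcal{N}(\bar{\boldsymbol{\mu}}_t,\bar\Sigma_t)}[\nabla^2_{\mathbf{x}}V(\mathbf{x})],$$ and let a particle started at $\mathbf{x}_0\in\mathbb{R}^n$ evolve according to $\frac{d\mathbf{x}_t}{dt}=\bar A_t\mathbf{x}_t+\bar{\mathbf{b}}_t$, where $$\bar A_t=-\tfrac12\bar\Sigma_t\,\mathbb{E}_{\mathbf{x}\sim\mathcal{N}(\bar{\boldsymbol{\mu}}_t,\bar\Sigma_t)}[\nabla^2_{\mathbf{x}}V(\mathbf{x})],\qquad \bar{\mathbf{b}}_t=-\bar\Sigma_t\,\mathbb{E}_{\mathbf{x}\sim\mathcal{N}(\bar{\boldsymbol{\mu}}_t,\bar\Sigma_t)}[\nabla_{\mathbf{x}}V(\mathbf{x})]-\bar A_t\bar{\boldsymbol{\mu}}_t.$$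 Then $$D_{\mathcal{M}}(\mathbf{x}_t,\bar{\boldsymbol{\mu}}_t,\bar\Sigma_t)=D_{\mathcal{M}}(\mathbf{x}_0,\bar{\boldsymbol{\mu}}_{t=0},\bar\Sigma_{t=0})\qquad\text{for all }t>0.$$
   Context: $V(\mathbf{x})=\log q(\mathbf{x})-\log p(\mathbf{x},\mathbf{z})$, where $p(\mathbf{x},\mathbf{z})=p(\mathbf{z}|\mathbf{x})p(\mathbf{x})$ is a joint density with $\mathbf{z}$ fixed and $q$ is the variational density at time $t$ (the Gaussian $\mathcal{N}(\bar{\boldsymbol{\mu}}_t,\bar\Sigma_t)$ itself, or a Gaussian mixture of which it is a component), so $V$ may depend on $t$; this dependence is suppressed in the notation. It is implicit that $V$ is twice continuously differentiable in $\mathbf{x}$, the expectations are finite, and $\bar\Sigma_t$ is symmetric positive definite, on the time interval where the flows are considered. *)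

theory Defs
  imports "HOL-Analysis.Analysis"
begin

definition pos_def_matrix :: "real ^ 'n ^ 'n \<Rightarrow> bool" where
  "pos_def_matrix A \<longleftrightarrow> transpose A = A \<and> (\<forall>v. v \<noteq> 0 \<longrightarrow> 0 < v \<bullet> (A *v v))"

text \<open>This is the squared distance: no square root is taken.\<close>

definition mahalanobis :: "real ^ 'n \<Rightarrow> real ^ 'n \<Rightarrow> real ^ 'n ^ 'n \<Rightarrow> real" where
  "mahalanobis x \<mu> \<Sigma> = (x - \<mu>) \<bullet> (matrix_inv \<Sigma> *v (x - \<mu>))"

text \<open>\<open>gaussian_density\<close> and \<open>gaussian\<close> are meaningful only for positive definite covariance.\<close>

definition gaussian_density :: "real ^ 'n \<Rightarrow> real ^ 'n ^ 'n \<Rightarrow> real ^ 'n \<Rightarrow> real" where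
  "gaussian_density \<mu> \<Sigma> x =
     exp (- (1 / 2) * ((x - \<mu>) \<bullet> (matrix_inv \<Sigma> *v (x - \<mu>)))) / sqrt ((2 * pi) ^ CARD('n) * det \<Sigma>)"

definition gaussian :: "real ^ 'n \<Rightarrow> real ^ 'n ^ 'n \<Rightarrow> (real ^ 'n) measure" where
  "gaussian \<mu> \<Sigma> = density lborel (\<lambda>x. ennreal (gaussian_density \<mu> \<Sigma> x))"

definition is_density :: "'a measure \<Rightarrow> ('a \<Rightarrow> real) \<Rightarrow> bool" where
  "is_density M f \<longleftrightarrow>
     f \<in> borel_measurable M \<and> (\<forall>x\<in>space M. 0 \<le> f x) \<and> (\<integral>\<^sup>+x. ennreal (f x) \<partial>M) = 1"

definition gaussian_mixture_density ::
    "nat \<Rightarrow> (nat \<Rightarrow> real) \<Rightarrow> (nat \<Rightarrow> real ^ 'n) \<Rightarrow> (nat \<Rightarrow> real ^ 'n ^ 'n) \<Rightarrow> real ^ 'n \<Rightarrow> real" where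
  "gaussian_mixture_density K w \<mu> \<Sigma> x = (\<Sum>k<K. w k * gaussian_density (\<mu> k) (\<Sigma> k) x)"

definition grad :: "(real ^ 'n \<Rightarrow> real) \<Rightarrow> real ^ 'n \<Rightarrow> real ^ 'n" where
  "grad f x = (\<chi> i. frechet_derivative f (at x) (axis i 1))"

definition hessian :: "(real ^ 'n \<Rightarrow> real) \<Rightarrow> real ^ 'n \<Rightarrow> real ^ 'n ^ 'n" where
  "hessian f x = jacobian (grad f) (at x)"

definition twice_continuously_differentiable :: "(real ^ 'n \<Rightarrow> real) \<Rightarrow> bool" where
  "twice_continuously_differentiable f \<longleftrightarrow>
     (\<forall>x. f differentiable at x) \<and> (\<forall>x. grad f differentiable at x) \<and> continuous_on UNIV (hessian f)"

end

theory Submission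
  imports Defs
begin

text \<open>
  With \<open>d = x - \<mu>\<close>, \<open>P = \<Sigma>\<^sup>-\<^sup>1\<close> and \<open>H\<close> the expected Hessian, the flows give
  \<open>P' = H\<close> and \<open>d' = - (1/2) \<Sigma> H d\<close>. So each of the two \<open>d'\<close> terms in the derivative of
  \<open>d \<bullet> P d\<close> equals \<open>- (1/2) d \<bullet> H d\<close>, and together they cancel \<open>d \<bullet> P' d\<close>.
\<close>

text \<open>A kernel vector \<open>v\<close> has \<open>v \<bullet> (S *v v) = 0\<close>, so
  positivity forces \<open>v = 0\<close>; a square matrix with trivial kernel is invertible.\<close>

lemma pos_def_matrix_invertible:
  assumes "pos_def_matrix S"
  shows "invertible S"
proof -
  have "v = 0" if "S *v v = 0" for v
    using assms that unfolding pos_def_matrix_def by (metis inner_zero_right less_irrefl)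
  then show ?thesis
    by (metis invertible_left_inverse matrix_left_invertible_ker)
qed

text \<open>Supplies the product rule for \<open>matrix_inv (\<Sigma> s) *v (x s - \<mu> s)\<close>,
  where matrix and vector both vary with time.\<close>

lemma bounded_bilinear_matrix_vector_mult:
  "bounded_bilinear ((*v) :: real ^ 'n ^ 'm \<Rightarrow> real ^ 'n \<Rightarrow> real ^ 'm)"
  unfolding bilinear_conv_bounded_bilinear[symmetric] bilinear_def
  by (auto intro!: linearI simp: matrix_vector_mult_add_rdistrib matrix_vector_right_distrib
      scaleR_matrix_vector_assoc matrix_vector_mult_scaleR)

lemma mahalanobis_has_zero_derivative:
  fixes x \<mu> :: "real \<Rightarrow> real ^ 'n" and \<Sigma> :: "real \<Rightarrow> real ^ 'n ^ 'n"
  assumes \<Sigma>: "pos_def_matrix (\<Sigma> t)"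
    and x: "(x has_vector_derivative x') (at t within I)"
    and \<mu>: "(\<mu> has_vector_derivative \<mu>') (at t within I)"
    and P: "((\<lambda>s. matrix_inv (\<Sigma> s)) has_vector_derivative H) (at t within I)"
    and diff: "x' - \<mu>' = - (1 / 2) *\<^sub>R (\<Sigma> t ** H) *v (x t - \<mu> t)"
  shows "((\<lambda>s. mahalanobis (x s) (\<mu> s) (\<Sigma> s)) has_vector_derivative 0) (at t within I)"
proof -
  define d where "d = x t - \<mu> t"
  define P where "P = matrix_inv (\<Sigma> t)"
  \<comment> \<open>\<open>matrix_inv\<close> is a Hilbert choice; invertibility guarantees that the
    chosen matrix is a two-sided inverse.\<close>
  have inv: "P ** \<Sigma> t = mat 1" "\<Sigma> t ** P = mat 1"
    using someI_ex[OF pos_def_matrix_invertible[OF \<Sigma>, unfolded invertible_def]]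
    unfolding P_def matrix_inv_def by blast+
  \<comment> \<open>Symmetry of \<open>\<Sigma> t\<close> lets it cross the inner product and meet
    \<open>P\<close> in \<open>P *v d\<close>, so symmetry of \<open>P\<close> itself need not be
    derived.\<close>
  have sym: "(\<Sigma> t *v u) \<bullet> v = u \<bullet> (\<Sigma> t *v v)" for u v
    using \<Sigma> unfolding pos_def_matrix_def by (metis dot_lmul_matrix transpose_matrix_vector)
  have d': "x' - \<mu>' = \<Sigma> t *v (- (1 / 2) *\<^sub>R (H *v d))"
    by (simp only: diff d_def matrix_vector_mult_scaleR matrix_vector_mul_assoc
        scaleR_matrix_vector_assoc[symmetric])
  have "P *v (x' - \<mu>') = - (1 / 2) *\<^sub>R (H *v d)"
    by (simp only: d' matrix_vector_mul_assoc inv matrix_vector_mul_lid)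
  moreover have "(x' - \<mu>') \<bullet> (P *v d) = - (1 / 2) *\<^sub>R (H *v d) \<bullet> d"
    by (simp only: d' sym matrix_vector_mul_assoc inv matrix_vector_mul_lid)
  \<comment> \<open>The left side has the shape that two applications of the product rule produce
    below.\<close>
  ultimately have zero: "d \<bullet> (P *v (x' - \<mu>') + H *v d) + (x' - \<mu>') \<bullet> (P *v d) = 0"
    by (simp add: inner_simps inner_commute)
  have dd: "((\<lambda>s. x s - \<mu> s) has_vector_derivative x' - \<mu>') (at t within I)"
    by (intro has_vector_derivative_diff x \<mu>)
  have "((\<lambda>s. matrix_inv (\<Sigma> s) *v (x s - \<mu> s)) has_vector_derivative
      P *v (x' - \<mu>') + H *v d) (at t within I)"
    using bounded_bilinear.has_vector_derivative[OF bounded_bilinear_matrix_vector_mult P dd]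
    by (simp add: P_def d_def)
  from bounded_bilinear.has_vector_derivative[OF bounded_bilinear_inner dd this]
  show ?thesis
    using zero by (simp add: mahalanobis_def P_def d_def)
qed

theorem theorem9:
  fixes I :: "real set"
    and K j :: nat
    and w :: "nat \<Rightarrow> real \<Rightarrow> real"
    and \<mu> :: "nat \<Rightarrow> real \<Rightarrow> real ^ 'n"
    and \<Sigma> :: "nat \<Rightarrow> real \<Rightarrow> real ^ 'n ^ 'n"
    and prior :: "real ^ 'n \<Rightarrow> real"
    and Mz :: "'z measure"
    and lik :: "real ^ 'n \<Rightarrow> 'z \<Rightarrow> real"
    and z :: 'z
    and q V :: "real \<Rightarrow> real ^ 'n \<Rightarrow> real"
    and A :: "real \<Rightarrow> real ^ 'n ^ 'n"
    and b x :: "real \<Rightarrow> real ^ 'n"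
    and x0 :: "real ^ 'n"
  \<comment> \<open>time interval \<open>[0, T)\<close>, \<open>[0, T]\<close> or \<open>[0, \<infinity>)\<close>\<close>
  assumes "is_interval I" and "I \<subseteq> {0..}" and "0 \<in> I"
  \<comment> \<open>the joint density \<open>p(x, z) = lik x z * prior x\<close>, with \<open>z\<close> fixed\<close>
    and "sigma_finite_measure Mz" and "z \<in> space Mz"
    and "is_density lborel prior" and "\<And>y. is_density Mz (lik y)"
    and "is_density (lborel \<Otimes>\<^sub>M Mz) (\<lambda>(y, u). lik y u * prior y)"
    and "\<And>y. 0 < lik y z * prior y"
  \<comment> \<open>the variational density, with component \<open>j\<close>; \<open>K = 1\<close> is a single Gaussian\<close>
    and "j < K"
    and "\<And>k t. k < K \<Longrightarrow> t \<in> I \<Longrightarrow> 0 < w k t"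
    and "\<And>t. t \<in> I \<Longrightarrow> (\<Sum>k<K. w k t) = 1"
    and "\<And>k t. k < K \<Longrightarrow> t \<in> I \<Longrightarrow> pos_def_matrix (\<Sigma> k t)"
    and "\<And>t y. t \<in> I \<Longrightarrow>
           q t y = gaussian_mixture_density K (\<lambda>k. w k t) (\<lambda>k. \<mu> k t) (\<lambda>k. \<Sigma> k t) y"
    and "\<And>t y. t \<in> I \<Longrightarrow> V t y = ln (q t y) - ln (lik y z * prior y)"
    and "\<And>t. t \<in> I \<Longrightarrow> twice_continuously_differentiable (V t)"
    and "\<And>t. t \<in> I \<Longrightarrow> integrable (gaussian (\<mu> j t) (\<Sigma> j t)) (grad (V t))"
    and "\<And>t. t \<in> I \<Longrightarrow> integrable (gaussian (\<mu> j t) (\<Sigma> j t)) (hessian (V t))"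
  \<comment> \<open>the flow of the Gaussian parameters\<close>
    and "\<And>t. t \<in> I \<Longrightarrow>
           (\<mu> j has_vector_derivative
              - (\<Sigma> j t *v (LINT y|gaussian (\<mu> j t) (\<Sigma> j t). grad (V t) y))) (at t within I)"
    and "\<And>t. t \<in> I \<Longrightarrow>
           ((\<lambda>s. matrix_inv (\<Sigma> j s)) has_vector_derivative
              (LINT y|gaussian (\<mu> j t) (\<Sigma> j t). hessian (V t) y)) (at t within I)"
  \<comment> \<open>the particle flow\<close>
    and "\<And>t. t \<in> I \<Longrightarrow>
           A t = - (1 / 2) *\<^sub>R (\<Sigma> j t ** (LINT y|gaussian (\<mu> j t) (\<Sigma> j t). hessian (V t) y))"
    and "\<And>t. t \<in> I \<Longrightarrow>
           b t = - (\<Sigma> j t *v (LINT y|gaussian (\<mu> j t) (\<Sigma> j t). grad (V t) y)) - A t *v \<mu> j t"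
    and "x 0 = x0"
    and "\<And>t. t \<in> I \<Longrightarrow> (x has_vector_derivative (A t *v x t + b t)) (at t within I)"
  shows "\<forall>t\<in>I. 0 < t \<longrightarrow>
           mahalanobis (x t) (\<mu> j t) (\<Sigma> j t) = mahalanobis x0 (\<mu> j 0) (\<Sigma> j 0)"
proof (intro ballI impI)
  fix t assume "t \<in> I"
  let ?D = "\<lambda>s. mahalanobis (x s) (\<mu> j s) (\<Sigma> j s)"
  have "(?D has_vector_derivative 0) (at s within I)" if s: "s \<in> I" for s
  proof (rule mahalanobis_has_zero_derivative)
    let ?H = "LINT y|gaussian (\<mu> j s) (\<Sigma> j s). hessian (V s) y"
    let ?g = "- (\<Sigma> j s *v (LINT y|gaussian (\<mu> j s) (\<Sigma> j s). grad (V s) y))"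
    show "pos_def_matrix (\<Sigma> j s)"
      using assms(10,13) s by blast
    show "(x has_vector_derivative (A s *v x s + b s)) (at s within I)"
      using assms(24) s by blast
    show "(\<mu> j has_vector_derivative ?g) (at s within I)"
      using assms(19) s by blast
    show "((\<lambda>s. matrix_inv (\<Sigma> j s)) has_vector_derivative ?H) (at s within I)"
      using assms(20) s by blast
    \<comment> \<open>The offset \<open>b\<close> consists of the velocity \<open>?g\<close> of the
      mean and \<open>- A s *v \<mu> j s\<close>: the first cancels, the second recentres the linear
      flow at the mean.\<close>
    have "A s *v x s + b s - ?g = A s *v (x s - \<mu> j s)"
      using assms(22)[OF s] by (simp add: matrix_vector_mult_diff_distrib)
    then show "A s *v x s + b s - ?g = - (1 / 2) *\<^sub>R (\<Sigma> j s ** ?H) *v (x s - \<mu> j s)"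
      using assms(21)[OF s] by simp
  qed
  \<comment> \<open>An interval is convex, so a zero derivative within \<open>I\<close>, one-sided
    at any endpoint, makes \<open>?D\<close> constant; the constant is then read off at time
    0.\<close>
  then obtain c where "\<And>s. s \<in> I \<Longrightarrow> ?D s = c"
    using has_vector_derivative_zero_constant[of I ?D] assms(1) is_interval_convex by blast
  then show "?D t = mahalanobis x0 (\<mu> j 0) (\<Sigma> j 0)"
    using \<open>t \<in> I\<close> \<open>0 \<in> I\<close> \<open>x 0 = x0\<close> by metis
qed

end
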